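(* A closed subspace of a Rudin space is a Rudin space.
   Context: For a $T_0$ space $X$, the specialization order is $x\le y$ iff $x\in\overline{\{y\}}$. $\mathsf{K}(X)$ is the set of nonempty compact saturated subsets (saturated = upper set in the specialization order). A family $\mathcal K\subseteq \mathsf K(X)$ is filtered if it is nonempty and for all $K_1,K_2\in\mathcal K$ there is $K_3\in\mathcal K$ with $K_3\subseteq K_1\cap K_2$. A nonempty subset $A$ is irreducible if whenever $A\subseteq F_1\cup F_2$ with $F_1,F_2$ closed, then $A\subseteq F_1$ or $A\subseteq F_2$. A Rudin set is a nonempty closed subset $A$ of $X$ for which there is a filtered family $\mathcal K\subseteq\mathsf K(X)$ such that $A$ is minimal (under inclusion) among the closed subsets of $X$ that meet every member of $\mathcal K$. A $T_0$ space $X$ is a Rudin space if every irreducible closed subset of $X$ is a Rudin set. *)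

theory Defs
  imports "HOL-Analysis.Abstract_Topological_Spaces"
begin

text \<open>A space is a value \<open>X\<close> of type \<^typ>\<open>'a topology\<close> with carrier \<open>topspace X\<close>.
  Since \<open>X closure_of {y}\<close> is empty for \<open>y\<close> outside the carrier, \<open>spec_le X x y\<close> forces both
  points into \<open>topspace X\<close>.\<close>

definition spec_le :: "'a topology \<Rightarrow> 'a \<Rightarrow> 'a \<Rightarrow> bool" where
  "spec_le X x y \<longleftrightarrow> x \<in> X closure_of {y}"

definition saturatedin :: "'a topology \<Rightarrow> 'a set \<Rightarrow> bool" where
  "saturatedin X S \<longleftrightarrow> S \<subseteq> topspace X \<and> (\<forall>x y. x \<in> S \<and> spec_le X x y \<longrightarrow> y \<in> S)"

definition compact_saturated_sets :: "'a topology \<Rightarrow> 'a set set" where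
  "compact_saturated_sets X = {K. K \<noteq> {} \<and> compactin X K \<and> saturatedin X K}"

definition filtered_family :: "'a set set \<Rightarrow> bool" where
  "filtered_family \<K> \<longleftrightarrow>
     \<K> \<noteq> {} \<and> (\<forall>K1 \<in> \<K>. \<forall>K2 \<in> \<K>. \<exists>K3 \<in> \<K>. K3 \<subseteq> K1 \<inter> K2)"

definition irreduciblein :: "'a topology \<Rightarrow> 'a set \<Rightarrow> bool" where
  "irreduciblein X A \<longleftrightarrow>
     A \<subseteq> topspace X \<and> A \<noteq> {} \<and>
     (\<forall>F1 F2. closedin X F1 \<and> closedin X F2 \<and> A \<subseteq> F1 \<union> F2 \<longrightarrow> A \<subseteq> F1 \<or> A \<subseteq> F2)"

definition meets_all :: "'a set \<Rightarrow> 'a set set \<Rightarrow> bool" where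
  "meets_all A \<K> \<longleftrightarrow> (\<forall>K \<in> \<K>. A \<inter> K \<noteq> {})"

definition rudin_set :: "'a topology \<Rightarrow> 'a set \<Rightarrow> bool" where
  "rudin_set X A \<longleftrightarrow>
     A \<noteq> {} \<and> closedin X A \<and>
     (\<exists>\<K>. \<K> \<subseteq> compact_saturated_sets X \<and> filtered_family \<K> \<and> meets_all A \<K> \<and>
        (\<forall>B. closedin X B \<and> meets_all B \<K> \<and> B \<subseteq> A \<longrightarrow> B = A))"

definition rudin_space :: "'a topology \<Rightarrow> bool" where
  "rudin_space X \<longleftrightarrow>
     t0_space X \<and> (\<forall>A. closedin X A \<and> irreduciblein X A \<longrightarrow> rudin_set X A)"

end

theory Submission
  imports Defs
begin

text \<open>If a filtered family \<open>\<K>\<close> witnesses that \<open>A \<subseteq> C\<close> is a Rudin set of \<open>X\<close>, then the traces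
  \<open>K \<inter> C\<close> witness it in \<open>C\<close>: they are nonempty because \<open>A\<close> meets every \<open>K\<close> inside \<open>C\<close>, compact
  because \<open>C\<close> is closed, and a subset of \<open>C\<close> meets \<open>K\<close> iff it meets \<open>K \<inter> C\<close>.\<close>

text \<open>The closure of \<open>{y}\<close> in the subspace lies in its closure in
  \<open>X\<close>, so a step up in the subspace order is a step up in \<open>X\<close>. The second
  conclusion keeps such steps inside \<open>S\<close>, so that traces of saturated sets stay
  saturated.\<close>

lemma spec_le_subtopologyD:
  assumes "spec_le (subtopology X S) x y"
  shows "spec_le X x y" "y \<in> S"
proof -
  have x: "x \<in> subtopology X S closure_of {y}"
    using assms by (simp add: spec_le_def)
  show "spec_le X x y"
    using closure_of_subtopology_subset[of X S "{y}"] x by (auto simp: spec_le_def)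
  show "y \<in> S"
  proof -
    have "x \<in> topspace (subtopology X S)"
      using x unfolding in_closure_of by blast
    \<comment> \<open>The whole carrier is an open neighbourhood of \<open>x\<close>, so it meets
      \<open>{y}\<close>.\<close>
    then have "y \<in> topspace (subtopology X S)"
      using x openin_topspace[of "subtopology X S"] unfolding in_closure_of by blast
    then show ?thesis by simp
  qed
qed

lemma saturatedin_subtopology_Int:
  assumes "saturatedin X K"
  shows "saturatedin (subtopology X S) (K \<inter> S)"
  unfolding saturatedin_def
proof (intro conjI allI impI)
  show "K \<inter> S \<subseteq> topspace (subtopology X S)"
    using assms by (auto simp: saturatedin_def)
  fix x y assume xy: "x \<in> K \<inter> S \<and> spec_le (subtopology X S) x y"
  then have "spec_le X x y" "y \<in> S"
    using spec_le_subtopologyD by metis+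
  with xy assms show "y \<in> K \<inter> S"
    unfolding saturatedin_def by blast
qed

lemma compact_saturated_sets_subtopology_Int:
  assumes "closedin X C" "K \<in> compact_saturated_sets X" "K \<inter> C \<noteq> {}"
  shows "K \<inter> C \<in> compact_saturated_sets (subtopology X C)"
  using assms
  by (auto simp: compact_saturated_sets_def compactin_subtopology saturatedin_subtopology_Int
      compact_Int_closedin)

text \<open>A cover of \<open>A\<close> by two closed sets of \<open>X\<close> restricts to a cover
  by their traces on \<open>S\<close>, which are closed in the subspace; one trace already contains
  \<open>A\<close>.\<close>

lemma irreduciblein_of_subtopology:
  assumes "irreduciblein (subtopology X S) A"
  shows "irreduciblein X A"
  unfolding irreduciblein_def
proof (intro conjI allI impI)
  have AS: "A \<subseteq> topspace X" "A \<subseteq> S" and "A \<noteq> {}"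
    using assms by (auto simp: irreduciblein_def)
  then show "A \<subseteq> topspace X" "A \<noteq> {}" by auto
  fix F G assume FG: "closedin X F \<and> closedin X G \<and> A \<subseteq> F \<union> G"
  then have "closedin (subtopology X S) (S \<inter> F)" "closedin (subtopology X S) (S \<inter> G)"
    by (simp_all add: closedin_subtopology_Int_closed)
  moreover have "A \<subseteq> S \<inter> F \<union> S \<inter> G"
    using FG AS by blast
  ultimately have "A \<subseteq> S \<inter> F \<or> A \<subseteq> S \<inter> G"
    using assms unfolding irreduciblein_def by blast
  then show "A \<subseteq> F \<or> A \<subseteq> G" by blast
qed

lemma rudin_set_subtopology:
  assumes C: "closedin X C" and A: "rudin_set X A" and AC: "A \<subseteq> C"
  shows "rudin_set (subtopology X C) A"
proof -
  obtain \<K> where ne: "A \<noteq> {}" and cl: "closedin X A"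
    and sub: "\<K> \<subseteq> compact_saturated_sets X" and fil: "filtered_family \<K>"
    and meets: "meets_all A \<K>"
    and least: "\<And>B. closedin X B \<Longrightarrow> meets_all B \<K> \<Longrightarrow> B \<subseteq> A \<Longrightarrow> B = A"
    using A unfolding rudin_set_def by blast
  define \<L> where "\<L> = (\<lambda>K. K \<inter> C) ` \<K>"
  have meets_iff: "meets_all B \<L> \<longleftrightarrow> meets_all B \<K>" if "B \<subseteq> C" for B
  proof -
    have "B \<inter> (K \<inter> C) = B \<inter> K" for K
      using that by blast
    then show ?thesis
      by (simp add: meets_all_def \<L>_def)
  qed
  have "K \<inter> C \<noteq> {}" if "K \<in> \<K>" for K
    using meets that AC unfolding meets_all_def by blast
  then have "\<L> \<subseteq> compact_saturated_sets (subtopology X C)"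
    using sub compact_saturated_sets_subtopology_Int[OF C] unfolding \<L>_def by blast
  moreover have "filtered_family \<L>"
    unfolding filtered_family_def
  proof (intro conjI ballI)
    show "\<L> \<noteq> {}"
      using fil by (simp add: filtered_family_def \<L>_def)
    fix L1 L2 assume "L1 \<in> \<L>" "L2 \<in> \<L>"
    then obtain K1 K2 where K: "K1 \<in> \<K>" "L1 = K1 \<inter> C" "K2 \<in> \<K>" "L2 = K2 \<inter> C"
      by (auto simp: \<L>_def)
    then obtain K3 where "K3 \<in> \<K>" "K3 \<subseteq> K1 \<inter> K2"
      using fil unfolding filtered_family_def by meson
    then have "K3 \<inter> C \<in> \<L>" "K3 \<inter> C \<subseteq> L1 \<inter> L2"
      using K by (auto simp: \<L>_def)
    then show "\<exists>L3\<in>\<L>. L3 \<subseteq> L1 \<inter> L2" by blast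
  qed
  moreover have "meets_all A \<L>"
    using meets AC by (simp add: meets_iff)
  \<comment> \<open>Since \<open>C\<close> is closed, \<open>B\<close> is closed in \<open>X\<close>
    as well; since \<open>B \<subseteq> A \<subseteq> C\<close>, it meets every member of
    \<open>\<K>\<close>. Minimality of \<open>A\<close> in \<open>X\<close> then applies.\<close>
  moreover have "B = A" if "closedin (subtopology X C) B" "meets_all B \<L>" "B \<subseteq> A" for B
    using that least AC C by (simp add: meets_iff closedin_closed_subtopology)
  moreover have "closedin (subtopology X C) A"
    using cl AC C by (simp add: closedin_closed_subtopology)
  ultimately show ?thesis
    using ne unfolding rudin_set_def by blast
qed

theorem proposition4p9:
  fixes X :: "'a topology" and C :: "'a set"
  assumes "rudin_space X" and "closedin X C"
  shows "rudin_space (subtopology X C)"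
  unfolding rudin_space_def
proof (intro conjI allI impI)
  show "t0_space (subtopology X C)"
    using assms(1) by (simp add: rudin_space_def t0_space_subtopology)
  fix A assume A: "closedin (subtopology X C) A \<and> irreduciblein (subtopology X C) A"
  \<comment> \<open>The assumption on \<open>X\<close> concerns sets closed and irreducible in
    \<open>X\<close>, so both properties are first lifted from the subspace. The Rudin property
    obtained in \<open>X\<close> then descends to \<open>C\<close>.\<close>
  then have "closedin X A" "A \<subseteq> C"
    using assms(2) by (simp_all add: closedin_closed_subtopology)
  moreover have "irreduciblein X A"
    using A irreduciblein_of_subtopology by blast
  ultimately show "rudin_set (subtopology X C) A"
    using assms rudin_set_subtopology unfolding rudin_space_def by blast
qed

end
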